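(* Let $\varepsilon>0$, $(s_0,t_0)\in\mathbb{R}^2$, and let $\phi\colon(s_0-\varepsilon,s_0+\varepsilon)\times(t_0-\varepsilon,t_0]\to\mathbb{R}^{1+2}$ be a $C^1$ immersion of the form $\phi(s,t)=(t,\gamma^1(s,t),\gamma^2(s,t))$ such that the restriction of $\phi$ to $(s_0-\varepsilon,s_0+\varepsilon)\times(t_0-\varepsilon,t_0)$ is $C^2$ and timelike with bounded mean curvature. Suppose that $\phi$ is null at the point $(s_0,t_0)$, i.e. the image of $d\phi_{(s_0,t_0)}$ is a null plane in $\mathbb{R}^{1+2}$. Then the curvature $k(\cdot,t)$ of the planar curves $\gamma(\cdot,t)=(\gamma^1(\cdot,t),\gamma^2(\cdot,t))$ blows up as $t\nearrow t_0$, i.e. $\limsup_{t\nearrow t_0}\sup_{|s-s_0|<\varepsilon}|k(s,t)|=\infty$, and $\phi$ is not $C^2$ on $(s_0-\varepsilon,s_0+\varepsilon)\times(t_0-\varepsilon,t_0]$.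
   Context: $\mathbb{R}^{1+2}$ is $\mathbb{R}^3$ with coordinates $(x^0,x^1,x^2)$ and the Minkowski metric $\eta=-(dx^0)^2+(dx^1)^2+(dx^2)^2$. For an immersion $\phi$ the induced bilinear form is $g_p(X,Y)=\eta(d\phi_p(X),d\phi_p(Y))$; $\phi$ is timelike at $p$ if $\det g_p<0$ and null at $p$ if $\det g_p=0$. The mean curvature scalar of a $C^2$ timelike immersion is the trace, with respect to $g$, of the second fundamental form taken with respect to a spacelike $\eta$-unit normal (its sign depends on the choice of normal; only its absolute value matters here). $C^1$ or $C^2$ on the half-open domain means that the corresponding partial derivatives exist and are continuous up to and including $t=t_0$ (one-sided in $t$ there). *)

theory Defs
  imports "HOL-Analysis.Analysis"
begin

type_synonym minkowski3 = "real \<times> real \<times> real"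

definition mink :: "minkowski3 \<Rightarrow> minkowski3 \<Rightarrow> real" where
  "mink = (\<lambda>(x0, x1, x2) (y0, y1, y2). - x0 * y0 + x1 * y1 + x2 * y2)"

text \<open>Everything below is relative to a domain \<open>D\<close> in the \<open>(s, t)\<close>-plane. Derivatives are taken within
  \<open>D\<close>, so they ignore the values of a function outside \<open>D\<close>, and they are one-sided at those boundary
  points that belong to \<open>D\<close>.\<close>

definition slice_s :: "(real \<times> real) set \<Rightarrow> real \<times> real \<Rightarrow> real set" where
  "slice_s D p = {s. (s, snd p) \<in> D}"

definition slice_t :: "(real \<times> real) set \<Rightarrow> real \<times> real \<Rightarrow> real set" where
  "slice_t D p = {t. (fst p, t) \<in> D}"

definition partial_s ::
    "(real \<times> real) set \<Rightarrow> (real \<times> real \<Rightarrow> 'a::real_normed_vector) \<Rightarrow> real \<times> real \<Rightarrow> 'a" where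
  "partial_s D f p = vector_derivative (\<lambda>s. f (s, snd p)) (at (fst p) within slice_s D p)"

definition partial_t ::
    "(real \<times> real) set \<Rightarrow> (real \<times> real \<Rightarrow> 'a::real_normed_vector) \<Rightarrow> real \<times> real \<Rightarrow> 'a" where
  "partial_t D f p = vector_derivative (\<lambda>t. f (fst p, t)) (at (snd p) within slice_t D p)"

definition C1_on :: "(real \<times> real) set \<Rightarrow> (real \<times> real \<Rightarrow> 'a::real_normed_vector) \<Rightarrow> bool" where
  "C1_on D f \<longleftrightarrow>
    (\<forall>p\<in>D. (\<lambda>s. f (s, snd p)) differentiable (at (fst p) within slice_s D p)) \<and>
    (\<forall>p\<in>D. (\<lambda>t. f (fst p, t)) differentiable (at (snd p) within slice_t D p)) \<and>
    continuous_on D (partial_s D f) \<and> continuous_on D (partial_t D f)"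

definition C2_on :: "(real \<times> real) set \<Rightarrow> (real \<times> real \<Rightarrow> 'a::real_normed_vector) \<Rightarrow> bool" where
  "C2_on D f \<longleftrightarrow> C1_on D f \<and> C1_on D (partial_s D f) \<and> C1_on D (partial_t D f)"

definition differential ::
    "(real \<times> real) set \<Rightarrow> (real \<times> real \<Rightarrow> minkowski3) \<Rightarrow> real \<times> real \<Rightarrow> real \<times> real \<Rightarrow> minkowski3" where
  "differential D \<phi> p = frechet_derivative \<phi> (at p within D)"

definition C1_immersion_on :: "(real \<times> real) set \<Rightarrow> (real \<times> real \<Rightarrow> minkowski3) \<Rightarrow> bool" where
  "C1_immersion_on D \<phi> \<longleftrightarrow> C1_on D \<phi> \<and> (\<forall>p\<in>D. inj (differential D \<phi> p))"

definition induced_form ::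
    "(real \<times> real) set \<Rightarrow> (real \<times> real \<Rightarrow> minkowski3) \<Rightarrow> real \<times> real \<Rightarrow> real \<times> real \<Rightarrow> real \<times> real \<Rightarrow> real"
  where "induced_form D \<phi> p X Y = mink (differential D \<phi> p X) (differential D \<phi> p Y)"

definition gram ::
    "(real \<times> real) set \<Rightarrow> (real \<times> real \<Rightarrow> minkowski3) \<Rightarrow> real \<times> real \<Rightarrow> real^2^2" where
  "gram D \<phi> p = (let g = induced_form D \<phi> p in
     vector [vector [g (1, 0) (1, 0), g (1, 0) (0, 1)],
             vector [g (0, 1) (1, 0), g (0, 1) (0, 1)]])"

definition timelike_at ::
    "(real \<times> real) set \<Rightarrow> (real \<times> real \<Rightarrow> minkowski3) \<Rightarrow> real \<times> real \<Rightarrow> bool" where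
  "timelike_at D \<phi> p \<longleftrightarrow> det (gram D \<phi> p) < 0"

definition null_at ::
    "(real \<times> real) set \<Rightarrow> (real \<times> real \<Rightarrow> minkowski3) \<Rightarrow> real \<times> real \<Rightarrow> bool" where
  "null_at D \<phi> p \<longleftrightarrow> det (gram D \<phi> p) = 0"

definition unit_normal_at ::
    "(real \<times> real) set \<Rightarrow> (real \<times> real \<Rightarrow> minkowski3) \<Rightarrow> real \<times> real \<Rightarrow> minkowski3 \<Rightarrow> bool" where
  "unit_normal_at D \<phi> p \<nu> \<longleftrightarrow> mink \<nu> \<nu> = 1 \<and> (\<forall>X. mink (differential D \<phi> p X) \<nu> = 0)"

text \<open>Since the ambient connection is flat, the second fundamental form with respect to \<open>\<nu>\<close> has the
  coefficients \<open>\<eta>(\<partial>\<^sub>i \<partial>\<^sub>j \<phi>, \<nu>)\<close>.\<close>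

definition second_fundamental_form ::
    "(real \<times> real) set \<Rightarrow> (real \<times> real \<Rightarrow> minkowski3) \<Rightarrow> real \<times> real \<Rightarrow> minkowski3 \<Rightarrow> real^2^2" where
  "second_fundamental_form D \<phi> p \<nu> =
     vector [vector [mink (partial_s D (partial_s D \<phi>) p) \<nu>, mink (partial_s D (partial_t D \<phi>) p) \<nu>],
             vector [mink (partial_t D (partial_s D \<phi>) p) \<nu>, mink (partial_t D (partial_t D \<phi>) p) \<nu>]]"

definition mean_curvature ::
    "(real \<times> real) set \<Rightarrow> (real \<times> real \<Rightarrow> minkowski3) \<Rightarrow> real \<times> real \<Rightarrow> minkowski3 \<Rightarrow> real" where
  "mean_curvature D \<phi> p \<nu> = trace (matrix_inv (gram D \<phi> p) ** second_fundamental_form D \<phi> p \<nu>)"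

text \<open>At a timelike point there are exactly two unit normals \<open>\<plusminus>\<nu>\<close>, and they give the same absolute value;
  hence the quantification over all of them. The trace is not divided by 2.\<close>

definition bounded_mean_curvature_on ::
    "(real \<times> real) set \<Rightarrow> (real \<times> real \<Rightarrow> minkowski3) \<Rightarrow> bool" where
  "bounded_mean_curvature_on D \<phi> \<longleftrightarrow>
    (\<exists>B. \<forall>p\<in>D. \<forall>\<nu>. unit_normal_at D \<phi> p \<nu> \<longrightarrow> \<bar>mean_curvature D \<phi> p \<nu>\<bar> \<le> B)"

text \<open>The signed curvature \<open>det (c', c'') / |c'|\<^sup>3\<close> of a regular plane curve in an arbitrary parametrization.\<close>

definition plane_curvature :: "(real \<Rightarrow> real \<times> real) \<Rightarrow> real \<Rightarrow> real" where
  "plane_curvature c s =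
    (let c' = (\<lambda>r. vector_derivative c (at r)); v = c' s; a = vector_derivative c' (at s)
     in (fst v * snd a - snd v * fst a) / norm v ^ 3)"

end

theory Submission
  imports Defs
begin

text \<open>Let \<open>v = \<gamma>\<^sub>t \<cdot> N\<close> be the normal velocity of the evolving plane curve and
  \<open>b = - \<gamma>\<^sub>s \<cdot> \<gamma>\<^sub>t / |\<gamma>\<^sub>s|\<^sup>2\<close>. The determinant of the induced form is \<open>|\<gamma>\<^sub>s|\<^sup>2 (v\<^sup>2 - 1)\<close>, so timelike means
  \<open>|v| < 1\<close> and null means \<open>|v| = 1\<close>. Rewriting the mean curvature \<open>H\<close> gives
  \<open>v\<^sub>t + b v\<^sub>s = (1 - v\<^sup>2) (k - H (1 - v\<^sup>2)\<^bsup>1/2\<^esup>)\<close>, hence \<open>artanh v\<close> changes at the bounded rate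
  \<open>k - H (1 - v\<^sup>2)\<^bsup>1/2\<^esup>\<close> along the field \<open>(b, 1)\<close> as long as \<open>k\<close> is bounded. As \<open>b\<close> is bounded up to \<open>t = t0\<close>,
  a maximum principle on backward cones bounds \<open>artanh v\<close> on the line \<open>s = s0\<close> uniformly for \<open>t < t0\<close>,
  so \<open>|v|\<close> cannot reach 1 at \<open>(s0, t0)\<close>. Only a bound on \<open>k\<close> near \<open>(s0, t0)\<close> is used, and such a bound
  also follows if \<open>\<phi>\<close> is \<open>C\<^sup>2\<close> up to \<open>t0\<close>, since \<open>\<gamma>\<^sub>s\<close> does not vanish.\<close>

subsection \<open>A maximum principle for transport equations\<close>

text \<open>Integrating along characteristics without solving their equation: for \<open>C' > C\<close>, at a maximum of
  \<open>w - C' (t - t1)\<close> over the backward cone a small step back along the characteristic direction stays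
  in the cone and would increase the function, unless the maximum lies on the bottom.\<close>

lemma transport_maximum_principle:
  fixes w :: "real \<times> real \<Rightarrow> real"
  defines "K \<equiv> \<lambda>M s0 t1 t2. {(s, t). t1 \<le> t \<and> t \<le> t2 \<and> \<bar>s - s0\<bar> \<le> M * (t2 - t)}"
  assumes "t1 \<le> t2" "M \<ge> 0"
    and cont: "continuous_on (K M s0 t1 t2) w"
    and deriv: "\<And>s t. (s, t) \<in> K M s0 t1 t2 \<Longrightarrow> t1 < t \<Longrightarrow>
      \<exists>b d. \<bar>b\<bar> \<le> M \<and> d \<le> C \<and> ((\<lambda>h. w (s + h * b, t + h)) has_real_derivative d) (at 0)"
    and bottom: "\<And>s. \<bar>s - s0\<bar> \<le> M * (t2 - t1) \<Longrightarrow> w (s, t1) \<le> A"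
  shows "w (s0, t2) \<le> A + C * (t2 - t1)"
proof -
  \<comment> \<open>Bounding \<open>s\<close> by the widest slice, at \<open>t = t1\<close>, puts
    the cone inside a compact box; the cone is the part of it cut out by a closed condition, hence
    compact.\<close>
  have K_eq: "K M s0 t1 t2 =
      (cbox (s0 - M * (t2 - t1), t1) (s0 + M * (t2 - t1), t2)) \<inter> {p. \<bar>fst p - s0\<bar> \<le> M * (t2 - snd p)}"
    (is "?K = ?B \<inter> ?S")
  proof -
    have "M * (t2 - t) \<le> M * (t2 - t1)" if "t1 \<le> t" for t
      using that \<open>M \<ge> 0\<close> by (intro mult_left_mono) auto
    then have "(s, t) \<in> ?K \<longleftrightarrow> (s, t) \<in> ?B \<inter> ?S" for s t
      unfolding K_def cbox_Pair_eq by (cases "t1 \<le> t") (force simp: abs_le_iff)+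
    then show ?thesis by auto
  qed
  have "closed ?S"
    by (intro closed_Collect_le continuous_intros)
  then have "compact ?K"
    unfolding K_eq by (intro compact_Int_closed compact_cbox)
  have apex: "(s0, t2) \<in> ?K"
    using assms by (auto simp: K_def)
  have strict: "w (s0, t2) \<le> A + C' * (t2 - t1)" if "C < C'" for C'
  proof -
    define u where "u p = w p - C' * (snd p - t1)" for p
    have "continuous_on ?K u"
      unfolding u_def by (intro continuous_intros cont)
    then obtain p where p: "p \<in> ?K" and max: "\<And>q. q \<in> ?K \<Longrightarrow> u q \<le> u p"
      using continuous_attains_sup[of ?K u] \<open>compact ?K\<close> apex by blast
    obtain s t where st: "p = (s, t)" by (cases p)
    have "t = t1"
    proof (rule ccontr)
      assume "t \<noteq> t1"
      then have "t1 < t" using p st by (auto simp: K_def)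
      obtain b d where b: "\<bar>b\<bar> \<le> M" and d: "d \<le> C"
        and der: "((\<lambda>h. w (s + h * b, t + h)) has_real_derivative d) (at 0)"
        using deriv p st \<open>t1 < t\<close> by blast
      have "((\<lambda>h. u (s + h * b, t + h)) has_real_derivative (d - C')) (at 0)"
        unfolding u_def by (auto intro!: derivative_eq_intros der)
      then obtain \<delta> where "\<delta> > 0" and
        dec: "\<And>h. 0 < h \<Longrightarrow> h < \<delta> \<Longrightarrow> u p < u (s + (0 - h) * b, t + (0 - h))"
        using DERIV_neg_dec_left[of _ "d - C'" 0] d \<open>C < C'\<close> st by force
      \<comment> \<open>Capping by \<open>t - t1\<close> keeps the step from falling below the
        bottom of the cone.\<close>
      define h where "h = min (\<delta> / 2) (t - t1)"
      have h: "0 < h" "h < \<delta>" "h \<le> t - t1"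
        using \<open>\<delta> > 0\<close> \<open>t1 < t\<close> by (auto simp: h_def)
      \<comment> \<open>Going back by \<open>h\<close> moves the point sideways by at most
        \<open>M * h\<close>, exactly the amount by which the cone widens.\<close>
      have "\<bar>h * b\<bar> \<le> M * h"
        using b h by (simp add: abs_mult mult.commute mult_right_mono)
      moreover have "\<bar>s - s0\<bar> \<le> M * (t2 - t)" "t \<le> t2"
        using p st by (auto simp: K_def)
      moreover have "M * (t2 - (t + (0 - h))) = M * (t2 - t) + M * h"
        by (simp add: algebra_simps)
      ultimately have "(s + (0 - h) * b, t + (0 - h)) \<in> ?K"
        using h unfolding K_def by auto
      with max dec h show False by fastforce
    qed
    then have "u p \<le> A"
      using bottom p st by (auto simp: u_def K_def)
    then show ?thesis
      using max[OF apex] by (simp add: u_def)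
  qed
  show ?thesis
  proof (rule field_le_epsilon)
    fix e :: real assume "e > 0"
    \<comment> \<open>The added 1 keeps the denominator positive in the degenerate case
      \<open>t1 = t2\<close>.\<close>
    define C' where "C' = C + e / (t2 - t1 + 1)"
    have "C < C'" using \<open>e > 0\<close> \<open>t1 \<le> t2\<close> by (simp add: C'_def)
    moreover have "(C' - C) * (t2 - t1) \<le> e"
      using \<open>e > 0\<close> \<open>t1 \<le> t2\<close> by (simp add: C'_def field_simps)
    ultimately show "w (s0, t2) \<le> A + C * (t2 - t1) + e"
      using strict[of C'] by (simp add: algebra_simps)
  qed
qed

subsection \<open>Differentials through partial derivatives\<close>

lemma slice_Times [simp]:
  "snd p \<in> T \<Longrightarrow> slice_s (S \<times> T) p = S" "fst p \<in> S \<Longrightarrow> slice_t (S \<times> T) p = T"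
  by (auto simp: slice_s_def slice_t_def)

lemma C1_on_Times_partials:
  assumes "C1_on (S \<times> T) f" "s \<in> S" "t \<in> T"
  shows "((\<lambda>s. f (s, t)) has_vector_derivative partial_s (S \<times> T) f (s, t)) (at s within S)"
    and "((\<lambda>t. f (s, t)) has_vector_derivative partial_t (S \<times> T) f (s, t)) (at t within T)"
  using assms unfolding C1_on_def partial_s_def partial_t_def
  by (auto simp: vector_derivative_works[symmetric] dest!: bspec[where x="(s, t)"])

text \<open>Combines the \<open>s\<close>-derivative at the point with a mean value argument in
  \<open>t\<close>, which uses convexity of \<open>T\<close> and continuity of the
  \<open>t\<close>-partial. \<open>T\<close> may be half-open, so the edge \<open>t = t0\<close> is
  covered.\<close>

lemma C1_on_Times_has_derivative:
  assumes C1: "C1_on (S \<times> T) f" and p: "s \<in> S" "t \<in> T" and "convex T"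
  shows "(f has_derivative (\<lambda>(a, b). a *\<^sub>R partial_s (S \<times> T) f (s, t) + b *\<^sub>R partial_t (S \<times> T) f (s, t)))
    (at (s, t) within S \<times> T)"
proof -
  have "((\<lambda>(s, t). f (s, t)) has_derivative
      (\<lambda>(a, b). a *\<^sub>R partial_s (S \<times> T) f (s, t) + blinfun_scaleR_left (partial_t (S \<times> T) f (s, t)) b))
    (at (s, t) within S \<times> T)"
  proof (rule has_derivative_partialsI)
    show "((\<lambda>s. f (s, t)) has_derivative (\<lambda>a. a *\<^sub>R partial_s (S \<times> T) f (s, t))) (at s within S)"
      using C1_on_Times_partials(1)[OF C1 p] by (simp add: has_vector_derivative_def)
    show "((\<lambda>t. f (s, t)) has_derivative blinfun_scaleR_left (partial_t (S \<times> T) f (s, t))) (at t within T)"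
      if "s \<in> S" "t \<in> T" for s t
      using C1_on_Times_partials(2)[OF C1 that] by (simp add: has_vector_derivative_def)
    have "continuous (at (s, t) within S \<times> T) (partial_t (S \<times> T) f)"
      using C1 p by (auto simp: C1_on_def continuous_on_eq_continuous_within)
    then show "continuous (at (s, t) within S \<times> T)
        (\<lambda>(s, t). blinfun_scaleR_left (partial_t (S \<times> T) f (s, t)))"
      unfolding case_prod_unfold prod.collapse
      by (rule bounded_linear.continuous[OF bounded_linear_blinfun_scaleR_left])
  qed (use p \<open>convex T\<close> in auto)
  then show ?thesis by simp
qed

lemma C1_on_open_line_derivative:
  assumes C1: "C1_on (S \<times> T) f" and "s \<in> S" "t \<in> T" "convex T" "open S" "open T"
  shows "((\<lambda>h. f (s + h * b, t + h)) has_vector_derivative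
    b *\<^sub>R partial_s (S \<times> T) f (s, t) + partial_t (S \<times> T) f (s, t)) (at 0)"
proof -
  have f: "(f has_derivative (\<lambda>(a, b). a *\<^sub>R partial_s (S \<times> T) f (s, t) + b *\<^sub>R partial_t (S \<times> T) f (s, t)))
      (at (s + 0 * b, t + 0))"
    using C1_on_Times_has_derivative[OF C1 assms(2-4)]
      at_within_open[of "(s, t)" "S \<times> T"] assms(2,3,5,6)
    by (simp add: open_Times)
  have "((\<lambda>h. (s + h * b, t + h)) has_derivative (\<lambda>h. (h * b, h))) (at 0)"
    by (auto intro!: derivative_eq_intros)
  from has_derivative_compose[OF this f] show ?thesis
    by (simp add: has_vector_derivative_def scaleR_add_right)
qed

text \<open>\<open>frechet_derivative\<close> is a choice, and within a set it is determined once
  arbitrarily small steps along each coordinate axis stay in the set. The limit point hypotheses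
  supply these steps, also at a one-sided edge.\<close>

lemma differential_Times:
  fixes f :: "real \<times> real \<Rightarrow> minkowski3"
  assumes C1: "C1_on (S \<times> T) f" and p: "s \<in> S" "t \<in> T" and "convex T" and lim: "s islimpt S" "t islimpt T"
  shows "differential (S \<times> T) f (s, t) (a, b)
    = a *\<^sub>R partial_s (S \<times> T) f (s, t) + b *\<^sub>R partial_t (S \<times> T) f (s, t)"
proof -
  have near: "\<exists>d. 0 < \<bar>d\<bar> \<and> \<bar>d\<bar> < e \<and> x + d \<in> I" if "x islimpt I" "e > 0" for I :: "real set" and x e
  proof -
    from that obtain y where "y \<in> I" "y \<noteq> x" "\<bar>y - x\<bar> < e"
      unfolding islimpt_approachable_real by blast
    then show ?thesis by (intro exI[of _ "y - x"]) auto
  qed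
  have "(f has_derivative (\<lambda>(a, b). a *\<^sub>R partial_s (S \<times> T) f (s, t) + b *\<^sub>R partial_t (S \<times> T) f (s, t)))
    (at (s, t) within S \<times> T)" (is "(f has_derivative ?L) _")
    by (rule C1_on_Times_has_derivative) (use assms in auto)
  moreover from this have "(f has_derivative differential (S \<times> T) f (s, t)) (at (s, t) within S \<times> T)"
    unfolding differential_def by (meson differentiableI frechet_derivative_works)
  ultimately have "?L = differential (S \<times> T) f (s, t)"
  proof (rule frechet_derivative_unique_within)
    fix i :: "real \<times> real" and e :: real
    assume "i \<in> Basis" "e > 0"
    then show "\<exists>d. 0 < \<bar>d\<bar> \<and> \<bar>d\<bar> < e \<and> (s, t) + d *\<^sub>R i \<in> S \<times> T"
      using near[OF lim(1)] near[OF lim(2)] p by (auto simp: Basis_prod_def)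
  qed
  then show ?thesis by (metis case_prod_conv)
qed

section \<open>Inverse and trace for 2 by 2 matrices\<close>

lemma matrix_inv_unique:
  fixes A :: "real^'n^'n"
  assumes "A ** B = mat 1" "B ** A = mat 1"
  shows "matrix_inv A = B"
proof -
  have "A ** matrix_inv A = mat 1 \<and> matrix_inv A ** A = mat 1"
    unfolding matrix_inv_def by (rule someI[of _ B]) (use assms in auto)
  then have "matrix_inv A = (B ** A) ** matrix_inv A" "B = B ** (A ** matrix_inv A)"
    using assms by auto
  then show ?thesis by (metis matrix_mul_assoc)
qed

lemma trace_matrix_inv_mult_2:
  fixes A B :: "real^2^2"
  assumes "det A \<noteq> 0"
  shows "trace (matrix_inv A ** B) =
    (A$2$2 * B$1$1 - A$1$2 * B$2$1 - A$2$1 * B$1$2 + A$1$1 * B$2$2) / det A"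
proof -
  define C :: "real^2^2" where
    "C = vector [vector [A$2$2 / det A, - A$1$2 / det A], vector [- A$2$1 / det A, A$1$1 / det A]]"
  have "matrix_inv A = C"
    by (rule matrix_inv_unique)
      (use assms in \<open>auto simp: vec_eq_iff forall_2 matrix_matrix_mult_def sum_2 C_def mat_def
        diff_divide_distrib[symmetric] det_2 field_simps\<close>)
  then show ?thesis
    by (simp add: trace_def matrix_matrix_mult_def sum_2 C_def add_divide_distrib diff_divide_distrib)
qed

text \<open>\<open>(x1, x2)\<close> and \<open>(y1, y2)\<close> play the roles of the derivatives of \<open>\<gamma>\<close> in \<open>s\<close> and \<open>t\<close>, and
  \<open>(- x2, x1) / r\<close> that of the unit normal of the curve.\<close>

lemma normal_velocity_derivative:
  fixes x1 x2 y1 y2 :: "real \<Rightarrow> real"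
  assumes "(x1 has_real_derivative b * p1 + q1) (at h)" "(x2 has_real_derivative b * p2 + q2) (at h)"
    and "(y1 has_real_derivative b * u1 + r1) (at h)" "(y2 has_real_derivative b * u2 + r2) (at h)"
    and pos: "(x1 h)\<^sup>2 + (x2 h)\<^sup>2 > 0"
    and b: "b = - (x1 h * y1 h + x2 h * y2 h) / ((x1 h)\<^sup>2 + (x2 h)\<^sup>2)"
  shows "((\<lambda>h. (x1 h * y2 h - x2 h * y1 h) / sqrt ((x1 h)\<^sup>2 + (x2 h)\<^sup>2)) has_real_derivative
    (b\<^sup>2 * (x1 h * p2 - x2 h * p1) + b * (x1 h * q2 - x2 h * q1) + b * (x1 h * u2 - x2 h * u1)
      + (x1 h * r2 - x2 h * r1)) / sqrt ((x1 h)\<^sup>2 + (x2 h)\<^sup>2)) (at h)"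
proof -
  define r where "r = sqrt ((x1 h)\<^sup>2 + (x2 h)\<^sup>2)"
  have r: "r > 0" "(x1 h)\<^sup>2 + (x2 h)\<^sup>2 = r\<^sup>2" using pos by (auto simp: r_def)
  have r2: "r * r = x1 h * x1 h + x2 h * x2 h" using r by (simp add: power2_eq_square)
  define X1 X2 Y1 Y2 a1 a2 c1 c2 where defs: "X1 = x1 h" "X2 = x2 h" "Y1 = y1 h" "Y2 = y2 h"
    "a1 = b * p1 + q1" "a2 = b * p2 + q2" "c1 = b * u1 + r1" "c2 = b * u2 + r2"
  have "((\<lambda>h. (x1 h * y2 h - x2 h * y1 h) / sqrt ((x1 h)\<^sup>2 + (x2 h)\<^sup>2)) has_real_derivative
     ((a1 * Y2 + X1 * c2 - a2 * Y1 - X2 * c1) * r - (X1 * Y2 - X2 * Y1) * ((X1 * a1 + X2 * a2) / r)) / (r * r)) (at h)"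
  proof (rule DERIV_divide[THEN DERIV_cong])
    show "((\<lambda>h. x1 h * y2 h - x2 h * y1 h) has_real_derivative a1 * Y2 + X1 * c2 - a2 * Y1 - X2 * c1) (at h)"
      using assms(1-4)[folded defs] by (auto intro!: derivative_eq_intros simp: defs(1-4))
    have "((\<lambda>h. (x1 h)\<^sup>2 + (x2 h)\<^sup>2) has_real_derivative 2 * (X1 * a1 + X2 * a2)) (at h)"
      using assms(1-4)[folded defs] by (auto intro!: derivative_eq_intros simp: defs(1-4))
    from DERIV_chain2[OF DERIV_real_sqrt[OF pos] this]
    show "((\<lambda>h. sqrt ((x1 h)\<^sup>2 + (x2 h)\<^sup>2)) has_real_derivative (X1 * a1 + X2 * a2) / r) (at h)"
      by (rule DERIV_cong) (use r(1) in \<open>simp add: r_def[symmetric] field_simps\<close>)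
  qed (use r in \<open>auto simp: r_def[symmetric] defs\<close>)
  also have "((a1 * Y2 + X1 * c2 - a2 * Y1 - X2 * c1) * r - (X1 * Y2 - X2 * Y1) * ((X1 * a1 + X2 * a2) / r)) / (r * r)
    = ((X1 * c2 - X2 * c1) + b * (X1 * a2 - X2 * a1)) / r"
  proof -
    have br: "b * (r * r) = - (X1 * Y1 + X2 * Y2)"
      using b r by (simp add: defs power2_eq_square)
    have r2: "r * r = X1 * X1 + X2 * X2" using r2 by (simp add: defs)
    \<comment> \<open>Here \<open>a\<close> and \<open>c\<close> are the derivatives of
      \<open>x\<close> and \<open>y\<close> along the line. Splitting \<open>a\<close> into its
      parts along and across \<open>X\<close> leaves \<open>- (X \<cdot> Y)\<close> times
      \<open>X1 * a2 - X2 * a1\<close>, and the choice of \<open>b\<close> makes the first factor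
      \<open>b * (r * r)\<close>. So the derivative of the length \<open>r\<close> cancels.\<close>
    have "(a1 * Y2 - a2 * Y1) * (r * r) - (X1 * Y2 - X2 * Y1) * (X1 * a1 + X2 * a2)
      = b * (r * r) * (X1 * a2 - X2 * a1)"
      unfolding br unfolding r2 by (simp add: algebra_simps)
    then have "((a1 * Y2 + X1 * c2 - a2 * Y1 - X2 * c1) * (r * r) - (X1 * Y2 - X2 * Y1) * (X1 * a1 + X2 * a2))
       = ((X1 * c2 - X2 * c1) + b * (X1 * a2 - X2 * a1)) * (r * r)"
      by (simp add: algebra_simps)
    moreover have "((a1 * Y2 + X1 * c2 - a2 * Y1 - X2 * c1) * r - (X1 * Y2 - X2 * Y1) * ((X1 * a1 + X2 * a2) / r)) / (r * r)
       = ((a1 * Y2 + X1 * c2 - a2 * Y1 - X2 * c1) * (r * r) - (X1 * Y2 - X2 * Y1) * (X1 * a1 + X2 * a2)) / (r * (r * r))"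
      using r by (simp add: field_simps)
    ultimately show ?thesis using r by simp
  qed
  finally show ?thesis
    by (simp add: defs r_def algebra_simps power2_eq_square)
qed

subsection \<open>Geometry of graphs over the time axis\<close>

text \<open>\<open>\<gamma>\<^sub>t \<cdot> N\<close> for the unit normal \<open>N = (- \<gamma>\<^sup>2\<^sub>s, \<gamma>\<^sup>1\<^sub>s) / |\<gamma>\<^sub>s|\<close>. The drift below is the speed in \<open>s\<close> for which
  a point of the curve moves purely in normal direction.\<close>

definition normal_velocity ::
    "(real \<times> real) set \<Rightarrow> (real \<times> real \<Rightarrow> minkowski3) \<Rightarrow> real \<times> real \<Rightarrow> real" where
  "normal_velocity D \<phi> p = (let x = snd (partial_s D \<phi> p); y = snd (partial_t D \<phi> p)
     in (fst x * snd y - snd x * fst y) / sqrt ((fst x)\<^sup>2 + (snd x)\<^sup>2))"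

definition drift ::
    "(real \<times> real) set \<Rightarrow> (real \<times> real \<Rightarrow> minkowski3) \<Rightarrow> real \<times> real \<Rightarrow> real" where
  "drift D \<phi> p = (let x = snd (partial_s D \<phi> p); y = snd (partial_t D \<phi> p)
     in - (fst x * fst y + snd x * snd y) / ((fst x)\<^sup>2 + (snd x)\<^sup>2))"

text \<open>The curvature of the curves of constant time, written with derivatives relative to
  \<open>D\<close>; on the half-open domain it thus makes sense at \<open>t = t0\<close> as
  well.\<close>

definition slice_curvature ::
    "(real \<times> real) set \<Rightarrow> (real \<times> real \<Rightarrow> minkowski3) \<Rightarrow> real \<times> real \<Rightarrow> real" where
  "slice_curvature D \<phi> p = (let x = snd (partial_s D \<phi> p); a = snd (partial_s D (partial_s D \<phi>) p)
     in (fst x * snd a - snd x * fst a) / sqrt ((fst x)\<^sup>2 + (snd x)\<^sup>2) ^ 3)"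

text \<open>Lagrange's identity applied to
  \<open>|x|\<^sup>2 (|y|\<^sup>2 - 1) - (x \<cdot> y)\<^sup>2\<close>.\<close>

lemma det_gram_graph:
  assumes "\<And>a b. differential D \<phi> p (a, b) = a *\<^sub>R (0, x1, x2) + b *\<^sub>R (1, y1, y2)"
  shows "det (gram D \<phi> p) = (x1 * y2 - x2 * y1)\<^sup>2 - (x1\<^sup>2 + x2\<^sup>2)"
  by (simp add: det_2 gram_def induced_form_def Let_def assms mink_def power2_eq_square algebra_simps)

text \<open>Up to normalisation, the left side is the second derivative of the graph in the
  direction \<open>(b, 1)\<close>, measured against the normal of the curve. It differs from the
  numerator of the mean curvature only in the coefficient of the pure \<open>s\<close>-derivative,
  and this difference is the curvature term. The two orders of the mixed derivative are kept apart,
  as in \<open>second_fundamental_form\<close>.\<close>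

lemma mean_curvature_graph:
  fixes b r v :: real
  assumes diff: "\<And>a b. differential D \<phi> p (a, b) = a *\<^sub>R (0, x1, x2) + b *\<^sub>R (1, y1, y2)"
    and second: "partial_s D (partial_s D \<phi>) p = (0, p1, p2)" "partial_t D (partial_s D \<phi>) p = (0, q1, q2)"
      "partial_s D (partial_t D \<phi>) p = (0, u1, u2)" "partial_t D (partial_t D \<phi>) p = (0, r1, r2)"
    and r: "r = sqrt (x1\<^sup>2 + x2\<^sup>2)" "r > 0"
    and v: "v = (x1 * y2 - x2 * y1) / r" "v\<^sup>2 < 1"
    and b: "b = - (x1 * y1 + x2 * y2) / (x1\<^sup>2 + x2\<^sup>2)"
  shows "\<exists>\<nu>. unit_normal_at D \<phi> p \<nu> \<and>
    (b\<^sup>2 * (x1 * p2 - x2 * p1) + b * (x1 * q2 - x2 * q1) + b * (x1 * u2 - x2 * u1) + (x1 * r2 - x2 * r1)) / r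
    = (1 - v\<^sup>2) * ((x1 * p2 - x2 * p1) / r ^ 3 - sqrt (1 - v\<^sup>2) * mean_curvature D \<phi> p \<nu>)"
proof -
  define c where "c = sqrt (1 - v\<^sup>2)"
  have c: "c > 0" "c\<^sup>2 = 1 - v\<^sup>2" using v by (auto simp: c_def)
  have rr: "x1\<^sup>2 + x2\<^sup>2 = r\<^sup>2" using r by simp
  have J: "x1 * y2 - x2 * y1 = v * r" using v r by simp
  \<comment> \<open>This is \<open>(v, N) / c\<close> for \<open>N = (- x2, x1) / r\<close>:
    orthogonality to \<open>(1, y1, y2)\<close> forces the time component
    \<open>v = y \<cdot> N\<close>, and \<open>(v, N)\<close> has \<open>mink\<close>-square
    \<open>1 - v\<^sup>2\<close>.\<close>
  define \<nu> where "\<nu> = (v / c, - x2 / (r * c), x1 / (r * c))"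
  have "mink \<nu> \<nu> = (x1\<^sup>2 + x2\<^sup>2) / (r * c)\<^sup>2 - v\<^sup>2 / c\<^sup>2"
    by (simp add: \<nu>_def mink_def power2_eq_square add_divide_distrib)
  also have "\<dots> = (1 - v\<^sup>2) / c\<^sup>2"
    using r c(1) unfolding rr by (simp add: power_mult_distrib diff_divide_distrib)
  also have "\<dots> = 1" using c(1) unfolding c(2)[symmetric] by simp
  finally have norm: "mink \<nu> \<nu> = 1" .
  have orth: "mink (differential D \<phi> p X) \<nu> = 0" for X
  proof -
    have "mink (differential D \<phi> p X) \<nu> = snd X * (x1 * y2 - x2 * y1 - v * r) / (r * c)"
      using r(2) c(1) by (cases X) (simp add: diff \<nu>_def mink_def field_simps)
    then show ?thesis by (simp add: J)
  qed
  define n11 n12 n21 n22 m where n_defs: "n11 = x1 * p2 - x2 * p1" "n12 = x1 * u2 - x2 * u1"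
    "n21 = x1 * q2 - x2 * q1" "n22 = x1 * r2 - x2 * r1" "m = x1 * y1 + x2 * y2"
  have det: "det (gram D \<phi> p) = - (c\<^sup>2 * r\<^sup>2)"
    unfolding det_gram_graph[OF diff] J rr c by (simp add: power_mult_distrib algebra_simps)
  have g: "gram D \<phi> p $ 1 $ 1 = r\<^sup>2" "gram D \<phi> p $ 1 $ 2 = m" "gram D \<phi> p $ 2 $ 1 = m"
    "gram D \<phi> p $ 2 $ 2 = y1\<^sup>2 + y2\<^sup>2 - 1"
    by (simp_all add: gram_def Let_def induced_form_def diff mink_def n_defs power2_eq_square
        rr[unfolded power2_eq_square])
  have h: "second_fundamental_form D \<phi> p \<nu> $ 1 $ 1 = n11 / (r * c)"
      "second_fundamental_form D \<phi> p \<nu> $ 1 $ 2 = n12 / (r * c)"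
      "second_fundamental_form D \<phi> p \<nu> $ 2 $ 1 = n21 / (r * c)"
      "second_fundamental_form D \<phi> p \<nu> $ 2 $ 2 = n22 / (r * c)"
    by (simp_all add: second_fundamental_form_def second mink_def \<nu>_def n_defs
        diff_divide_distrib mult.commute)
  \<comment> \<open>The trace against the adjugate of the induced form, with the common factor
    \<open>1 / (r * c)\<close> taken out.\<close>
  define G where "G = (y1\<^sup>2 + y2\<^sup>2 - 1) * n11 - m * n21 - m * n12 + r\<^sup>2 * n22"
  have "mean_curvature D \<phi> p \<nu> = (G / (r * c)) / - (c\<^sup>2 * r\<^sup>2)"
    unfolding mean_curvature_def using r(2) c(1)
    by (subst trace_matrix_inv_mult_2)
      (simp_all add: det g h G_def add_divide_distrib diff_divide_distrib)
  then have H: "c\<^sup>2 * (c * mean_curvature D \<phi> p \<nu>) = - G / r ^ 3"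
    using r(2) c(1) by (simp add: field_simps power2_eq_square power3_eq_cube)
  have "r\<^sup>2 * (y1\<^sup>2 + y2\<^sup>2) = m\<^sup>2 + (x1 * y2 - x2 * y1)\<^sup>2"
    unfolding rr[symmetric] n_defs by (simp add: power2_eq_square algebra_simps)
  then have m2: "m\<^sup>2 = r\<^sup>2 * (y1\<^sup>2 + y2\<^sup>2 - v\<^sup>2)"
    unfolding J by (simp add: power_mult_distrib algebra_simps)
  have br: "b = - m / r\<^sup>2" using b by (simp add: n_defs rr)
  have rb: "r\<^sup>2 * b = - m" using r(2) by (simp add: br)
  have "r\<^sup>2 * (r\<^sup>2 * b\<^sup>2) = (r\<^sup>2 * b)\<^sup>2"
    by (simp add: power2_eq_square)
  also have "\<dots> = r\<^sup>2 * (y1\<^sup>2 + y2\<^sup>2 - v\<^sup>2)"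
    unfolding rb by (simp add: m2)
  finally have rb2: "r\<^sup>2 * b\<^sup>2 = y1\<^sup>2 + y2\<^sup>2 - v\<^sup>2"
    unfolding mult_left_cancel[OF less_imp_neq[OF zero_less_power[OF r(2)], symmetric]] .
  have "r\<^sup>2 * (b\<^sup>2 * n11 + b * n21 + b * n12 + n22)
      = (r\<^sup>2 * b\<^sup>2) * n11 + (r\<^sup>2 * b) * n21 + (r\<^sup>2 * b) * n12 + r\<^sup>2 * n22"
    by (simp add: algebra_simps)
  \<comment> \<open>Only the coefficients of \<open>n11\<close> differ:
    \<open>y1\<^sup>2 + y2\<^sup>2 - v\<^sup>2\<close> here,
    \<open>y1\<^sup>2 + y2\<^sup>2 - 1\<close> in \<open>G\<close>.\<close>
  also have "\<dots> = c\<^sup>2 * n11 + G"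
    unfolding rb rb2 c(2) G_def by (simp add: algebra_simps)
  finally have "r\<^sup>2 * (b\<^sup>2 * n11 + b * n21 + b * n12 + n22) = c\<^sup>2 * n11 + G" .
  then have "(b\<^sup>2 * n11 + b * n21 + b * n12 + n22) / r = c\<^sup>2 * n11 / r ^ 3 + G / r ^ 3"
    using r(2) by (simp add: field_simps power2_eq_square power3_eq_cube)
  also have "\<dots> = c\<^sup>2 * (n11 / r ^ 3 - c * mean_curvature D \<phi> p \<nu>)"
    unfolding right_diff_distrib H by simp
  finally show ?thesis
    using norm orth unfolding unit_normal_at_def n_defs(1-4) c(2) unfolding c_def by blast
qed

text \<open>Used for time components: that of a graph is constant in \<open>s\<close> and the
  identity in \<open>t\<close>, and those of its first partials are constant.\<close>

lemma fst_vector_derivative_affine: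
  fixes f :: "real \<Rightarrow> real \<times> 'a::real_normed_vector"
  assumes "(f has_vector_derivative f') (at x within S)" "x islimpt S" "x \<in> S"
    and "\<And>y. y \<in> S \<Longrightarrow> fst (f y) = c + d * y"
  shows "fst f' = d"
proof (rule vector_derivative_unique_within)
  show "at x within S \<noteq> bot" using assms by (simp add: trivial_limit_within)
  show "((\<lambda>y. fst (f y)) has_vector_derivative fst f') (at x within S)"
    by (rule bounded_linear.has_vector_derivative[OF bounded_linear_fst assms(1)])
  have "((\<lambda>y. c + d * y) has_vector_derivative d) (at x within S)"
    by (auto intro!: derivative_eq_intros)
  then show "((\<lambda>y. fst (f y)) has_vector_derivative d) (at x within S)"
    by (rule has_vector_derivative_transform[rotated 2]) (use assms in auto)
qed

lemma graph_first_partials: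
  fixes \<phi> :: "real \<times> real \<Rightarrow> minkowski3"
  assumes C1: "C1_on (S \<times> T) \<phi>" and p: "s \<in> S" "t \<in> T" and lim: "s islimpt S" "t islimpt T"
    and graph: "\<And>p. p \<in> S \<times> T \<Longrightarrow> fst (\<phi> p) = snd p"
  shows "fst (partial_s (S \<times> T) \<phi> (s, t)) = 0" "fst (partial_t (S \<times> T) \<phi> (s, t)) = 1"
  using fst_vector_derivative_affine[OF C1_on_Times_partials(1)[OF C1 p] lim(1) p(1), of t 0]
    fst_vector_derivative_affine[OF C1_on_Times_partials(2)[OF C1 p] lim(2) p(2), of 0 1] graph p
  by auto

lemma graph_differential:
  fixes \<phi> :: "real \<times> real \<Rightarrow> minkowski3"
  assumes C1: "C1_on (S \<times> T) \<phi>" and p: "s \<in> S" "t \<in> T" and lim: "s islimpt S" "t islimpt T"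
    and "convex T" and graph: "\<And>p. p \<in> S \<times> T \<Longrightarrow> fst (\<phi> p) = snd p"
  defines "x \<equiv> snd (partial_s (S \<times> T) \<phi> (s, t))" and "y \<equiv> snd (partial_t (S \<times> T) \<phi> (s, t))"
  shows "differential (S \<times> T) \<phi> (s, t) (a, b) = a *\<^sub>R (0, fst x, snd x) + b *\<^sub>R (1, fst y, snd y)"
  unfolding differential_Times[OF C1 p \<open>convex T\<close> lim] x_def y_def
  using graph_first_partials[OF C1 p lim graph] by (simp add: prod_eq_iff)

text \<open>For nonzero \<open>\<gamma>\<^sub>s\<close> the determinant is
  \<open>|\<gamma>\<^sub>s|\<^sup>2 (v\<^sup>2 - 1)\<close>. That \<open>\<gamma>\<^sub>s\<close> is
  nonzero follows from the strict sign at timelike points, and from injectivity of the differential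
  in general, because \<open>\<phi>\<^sub>s\<close> has no time component.\<close>

lemma graph_timelike_null:
  fixes \<phi> :: "real \<times> real \<Rightarrow> minkowski3"
  assumes "C1_on (S \<times> T) \<phi>" "s \<in> S" "t \<in> T" "s islimpt S" "t islimpt T"
    and "convex T" and "\<And>p. p \<in> S \<times> T \<Longrightarrow> fst (\<phi> p) = snd p"
  defines "x \<equiv> snd (partial_s (S \<times> T) \<phi> (s, t))"
  shows "timelike_at (S \<times> T) \<phi> (s, t) \<Longrightarrow> (fst x)\<^sup>2 + (snd x)\<^sup>2 > 0"
    and "timelike_at (S \<times> T) \<phi> (s, t) \<Longrightarrow> (normal_velocity (S \<times> T) \<phi> (s, t))\<^sup>2 < 1"
    and "inj (differential (S \<times> T) \<phi> (s, t)) \<Longrightarrow> (fst x)\<^sup>2 + (snd x)\<^sup>2 > 0"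
    and "inj (differential (S \<times> T) \<phi> (s, t)) \<Longrightarrow> null_at (S \<times> T) \<phi> (s, t) \<Longrightarrow>
      (normal_velocity (S \<times> T) \<phi> (s, t))\<^sup>2 = 1"
proof -
  define y where "y = snd (partial_t (S \<times> T) \<phi> (s, t))"
  note d = graph_differential[OF assms(1-7), folded x_def y_def]
  let ?r2 = "(fst x)\<^sup>2 + (snd x)\<^sup>2" and ?J = "fst x * snd y - snd x * fst y"
  have det: "det (gram (S \<times> T) \<phi> (s, t)) = ?J\<^sup>2 - ?r2"
    by (rule det_gram_graph[OF d])
  have v: "(normal_velocity (S \<times> T) \<phi> (s, t))\<^sup>2 = ?J\<^sup>2 / ?r2"
    by (simp add: normal_velocity_def Let_def x_def y_def power_divide)
  show pos: "?r2 > 0" if "timelike_at (S \<times> T) \<phi> (s, t)"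
    using that zero_le_power2[of ?J] unfolding timelike_at_def det by linarith
  show "(normal_velocity (S \<times> T) \<phi> (s, t))\<^sup>2 < 1" if "timelike_at (S \<times> T) \<phi> (s, t)"
    using that pos[OF that] unfolding timelike_at_def det v by simp
  show pos: "?r2 > 0" if "inj (differential (S \<times> T) \<phi> (s, t))"
  proof (rule ccontr)
    assume "\<not> ?r2 > 0"
    then have "fst x = 0" "snd x = 0" by (auto simp: sum_power2_gt_zero_iff)
    then have "differential (S \<times> T) \<phi> (s, t) (1, 0) = differential (S \<times> T) \<phi> (s, t) (0, 0)"
      using d[of 1 0] d[of 0 0] by (simp add: zero_prod_def)
    with that show False by (auto dest: injD)
  qed
  show "(normal_velocity (S \<times> T) \<phi> (s, t))\<^sup>2 = 1"
    if "inj (differential (S \<times> T) \<phi> (s, t))" "null_at (S \<times> T) \<phi> (s, t)"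
  proof -
    have "?J\<^sup>2 = ?r2" using that(2) unfolding null_at_def det by simp
    then show ?thesis unfolding v using pos[OF that(1)] by (metis divide_self less_irrefl)
  qed
qed

lemma real_open_islimpt: "open S \<Longrightarrow> s \<in> S \<Longrightarrow> s islimpt S" for s :: real
  using interior_limit_point interior_open by blast

lemma has_vector_derivative_snd_components:
  assumes "((f :: real \<Rightarrow> 'a::real_normed_vector \<times> 'b::real_normed_vector \<times> 'c::real_normed_vector) has_vector_derivative f') F"
  shows "((\<lambda>h. fst (snd (f h))) has_vector_derivative fst (snd f')) F"
    and "((\<lambda>h. snd (snd (f h))) has_vector_derivative snd (snd f')) F"
proof -
  have "((\<lambda>h. snd (f h)) has_vector_derivative snd f') F"
    by (rule bounded_linear.has_vector_derivative[OF bounded_linear_snd assms])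
  then show "((\<lambda>h. fst (snd (f h))) has_vector_derivative fst (snd f')) F"
    and "((\<lambda>h. snd (snd (f h))) has_vector_derivative snd (snd f')) F"
    by (rule bounded_linear.has_vector_derivative[OF bounded_linear_fst]
        bounded_linear.has_vector_derivative[OF bounded_linear_snd])+
qed

text \<open>The line is straight, with \<open>b\<close> frozen at its value at
  \<open>(s, t)\<close>; its direction at \<open>h = 0\<close> is all that enters.
  \<open>normal_velocity_derivative\<close> yields the combination of second derivatives that
  \<open>mean_curvature_graph\<close> rewrites through curvature and mean curvature.\<close>

lemma normal_velocity_line_derivative:
  fixes \<phi> :: "real \<times> real \<Rightarrow> minkowski3"
  assumes C2: "C2_on (S \<times> T) \<phi>" and "open S" "open T" "convex T" and p: "s \<in> S" "t \<in> T"
    and graph: "\<And>p. p \<in> S \<times> T \<Longrightarrow> fst (\<phi> p) = snd p"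
    and timelike: "timelike_at (S \<times> T) \<phi> (s, t)"
  defines "U \<equiv> S \<times> T"
  defines "b \<equiv> drift U \<phi> (s, t)" and "v \<equiv> normal_velocity U \<phi> (s, t)"
  shows "\<exists>\<nu>. unit_normal_at U \<phi> (s, t) \<nu> \<and>
    ((\<lambda>h. normal_velocity U \<phi> (s + h * b, t + h)) has_real_derivative
      (1 - v\<^sup>2) * (slice_curvature U \<phi> (s, t) - sqrt (1 - v\<^sup>2) * mean_curvature U \<phi> (s, t) \<nu>)) (at 0)"
proof -
  have lim: "s islimpt S" "t islimpt T" if "s \<in> S" "t \<in> T" for s t
    using that assms(2,3) by (auto intro: real_open_islimpt)
  have C1: "C1_on U \<phi>" "C1_on U (partial_s U \<phi>)" "C1_on U (partial_t U \<phi>)"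
    using C2 by (auto simp: C2_on_def U_def)
  define X Y where "X = partial_s U \<phi>" and "Y = partial_t U \<phi>"
  note XY = X_def[symmetric] Y_def[symmetric]
  have first: "fst (X (s, t)) = 0" "fst (Y (s, t)) = 1" if "s \<in> S" "t \<in> T" for s t
    using graph_first_partials[OF C1(1)[unfolded U_def] that lim[OF that] graph]
    by (auto simp: X_def Y_def U_def)
  \<comment> \<open>The time components of \<open>X\<close> and \<open>Y\<close> are the constants 0
    and 1, so their derivatives vanish.\<close>
  have second: "fst (partial_s U X (s, t)) = 0" "fst (partial_s U Y (s, t)) = 0"
    "fst (partial_t U X (s, t)) = 0" "fst (partial_t U Y (s, t)) = 0"
    using fst_vector_derivative_affine[OF C1_on_Times_partials(1)[OF C1(2)[unfolded U_def] p] lim(1)[OF p] p(1), of 0 0]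
      fst_vector_derivative_affine[OF C1_on_Times_partials(2)[OF C1(2)[unfolded U_def] p] lim(2)[OF p] p(2), of 0 0]
      fst_vector_derivative_affine[OF C1_on_Times_partials(1)[OF C1(3)[unfolded U_def] p] lim(1)[OF p] p(1), of 1 0]
      fst_vector_derivative_affine[OF C1_on_Times_partials(2)[OF C1(3)[unfolded U_def] p] lim(2)[OF p] p(2), of 1 0]
      p first
    by (simp_all add: X_def Y_def U_def)
  let ?x1 = "\<lambda>h. fst (snd (X (s + h * b, t + h)))" and ?x2 = "\<lambda>h. snd (snd (X (s + h * b, t + h)))"
  let ?y1 = "\<lambda>h. fst (snd (Y (s + h * b, t + h)))" and ?y2 = "\<lambda>h. snd (snd (Y (s + h * b, t + h)))"
  let ?ss = "partial_s U X (s, t)" and ?st = "partial_s U Y (s, t)"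
  let ?ts = "partial_t U X (s, t)" and ?tt = "partial_t U Y (s, t)"
  have lineX: "((\<lambda>h. X (s + h * b, t + h)) has_vector_derivative b *\<^sub>R ?ss + ?ts) (at 0)"
    unfolding X_def U_def
    by (rule C1_on_open_line_derivative[OF C1(2)[unfolded U_def] p \<open>convex T\<close> assms(2,3)])
  have lineY: "((\<lambda>h. Y (s + h * b, t + h)) has_vector_derivative b *\<^sub>R ?st + ?tt) (at 0)"
    unfolding Y_def U_def
    by (rule C1_on_open_line_derivative[OF C1(3)[unfolded U_def] p \<open>convex T\<close> assms(2,3)])
  have pos: "(?x1 0)\<^sup>2 + (?x2 0)\<^sup>2 > 0" and v2: "v\<^sup>2 < 1"
    using graph_timelike_null(1,2)[OF C1(1)[unfolded U_def] p lim[OF p] \<open>convex T\<close> graph timelike]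
    by (auto simp: X_def U_def v_def)
  have beq: "b = - (?x1 0 * ?y1 0 + ?x2 0 * ?y2 0) / ((?x1 0)\<^sup>2 + (?x2 0)\<^sup>2)"
    by (simp add: b_def drift_def Let_def X_def Y_def)
  have veq: "v = (?x1 0 * ?y2 0 - ?x2 0 * ?y1 0) / sqrt ((?x1 0)\<^sup>2 + (?x2 0)\<^sup>2)"
    by (simp add: v_def normal_velocity_def Let_def X_def Y_def)
  have keq: "slice_curvature U \<phi> (s, t) =
      (?x1 0 * snd (snd ?ss) - ?x2 0 * fst (snd ?ss)) / sqrt ((?x1 0)\<^sup>2 + (?x2 0)\<^sup>2) ^ 3"
    by (simp add: slice_curvature_def Let_def X_def)
  have diff: "differential U \<phi> (s, t) (a, b) =
      a *\<^sub>R (0, ?x1 0, ?x2 0) + b *\<^sub>R (1, ?y1 0, ?y2 0)" for a b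
    using graph_differential[OF C1(1)[unfolded U_def] p lim[OF p] \<open>convex T\<close> graph]
    by (simp add: X_def Y_def U_def)
  obtain \<nu> where \<nu>: "unit_normal_at U \<phi> (s, t) \<nu>" and
    eq: "(b\<^sup>2 * (?x1 0 * snd (snd ?ss) - ?x2 0 * fst (snd ?ss)) + b * (?x1 0 * snd (snd ?ts) - ?x2 0 * fst (snd ?ts))
       + b * (?x1 0 * snd (snd ?st) - ?x2 0 * fst (snd ?st)) + (?x1 0 * snd (snd ?tt) - ?x2 0 * fst (snd ?tt)))
       / sqrt ((?x1 0)\<^sup>2 + (?x2 0)\<^sup>2)
     = (1 - v\<^sup>2) * ((?x1 0 * snd (snd ?ss) - ?x2 0 * fst (snd ?ss)) / sqrt ((?x1 0)\<^sup>2 + (?x2 0)\<^sup>2) ^ 3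
         - sqrt (1 - v\<^sup>2) * mean_curvature U \<phi> (s, t) \<nu>)"
    using mean_curvature_graph[OF diff, of "fst (snd ?ss)" "snd (snd ?ss)" "fst (snd ?ts)" "snd (snd ?ts)"
        "fst (snd ?st)" "snd (snd ?st)" "fst (snd ?tt)" "snd (snd ?tt)", OF _ _ _ _ refl _ veq v2 beq] second pos
    unfolding XY by (auto simp: prod_eq_iff)
  note dX = has_vector_derivative_snd_components[OF lineX] and dY = has_vector_derivative_snd_components[OF lineY]
  have d: "(?x1 has_real_derivative b * fst (snd ?ss) + fst (snd ?ts)) (at 0)"
      "(?x2 has_real_derivative b * snd (snd ?ss) + snd (snd ?ts)) (at 0)"
      "(?y1 has_real_derivative b * fst (snd ?st) + fst (snd ?tt)) (at 0)"
      "(?y2 has_real_derivative b * snd (snd ?st) + snd (snd ?tt)) (at 0)"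
    using dX dY by (simp_all add: has_real_derivative_iff_has_vector_derivative)
  have "((\<lambda>h. (?x1 h * ?y2 h - ?x2 h * ?y1 h) / sqrt ((?x1 h)\<^sup>2 + (?x2 h)\<^sup>2)) has_real_derivative
     (1 - v\<^sup>2) * (slice_curvature U \<phi> (s, t) - sqrt (1 - v\<^sup>2) * mean_curvature U \<phi> (s, t) \<nu>)) (at 0)"
    unfolding keq eq[symmetric]
    by (rule normal_velocity_derivative[OF d pos beq])
  then show ?thesis
    using \<nu> unfolding normal_velocity_def Let_def XY by blast
qed

section \<open>Comparing the open and the half-open domain\<close>

lemma islimpt_infinite_connected: "connected S \<Longrightarrow> infinite S \<Longrightarrow> x \<in> S \<Longrightarrow> x islimpt S"
  for x :: "'a::metric_space"
  by (rule connected_imp_perfect) auto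

text \<open>At a time in the open set \<open>T\<close>, the filters within \<open>T\<close> and
  within \<open>T'\<close> coincide, and the \<open>s\<close>-slices are the same set.\<close>

lemma partials_Times_restrict:
  assumes "open T" "T \<subseteq> T'" "p \<in> S \<times> T"
  shows "partial_s (S \<times> T') f p = partial_s (S \<times> T) f p"
    and "partial_t (S \<times> T') f p = partial_t (S \<times> T) f p"
  using assms at_within_open_subset[of "snd p" T T'] at_within_open[of "snd p" T]
  by (auto simp: partial_s_def partial_t_def mem_Times_iff)

lemma partial_s_Times_cong:
  assumes "\<And>s. s \<in> S \<Longrightarrow> f (s, snd p) = g (s, snd p)" "p \<in> S \<times> T"
  shows "partial_s (S \<times> T) f p = partial_s (S \<times> T) g p"
  unfolding partial_s_def
  by (rule vector_derivative_cong_eq) (use assms in \<open>auto simp: mem_Times_iff\<close>)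

lemma graph_quantities_restrict:
  assumes "open T" "T \<subseteq> T'" "p \<in> S \<times> T"
  shows "normal_velocity (S \<times> T') \<phi> p = normal_velocity (S \<times> T) \<phi> p"
    and "drift (S \<times> T') \<phi> p = drift (S \<times> T) \<phi> p"
    and "slice_curvature (S \<times> T') \<phi> p = slice_curvature (S \<times> T) \<phi> p"
proof -
  note r = partials_Times_restrict[OF assms(1,2)]
  \<comment> \<open>The outer derivative sees the inner one along the whole \<open>s\<close>-slice,
    so the first partials have to agree on all of it and not just at \<open>p\<close>.\<close>
  have "partial_s (S \<times> T) (partial_s (S \<times> T') \<phi>) p = partial_s (S \<times> T) (partial_s (S \<times> T) \<phi>) p"
    by (rule partial_s_Times_cong) (use assms in \<open>auto simp: mem_Times_iff intro!: r\<close>)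
  then show "normal_velocity (S \<times> T') \<phi> p = normal_velocity (S \<times> T) \<phi> p"
    and "drift (S \<times> T') \<phi> p = drift (S \<times> T) \<phi> p"
    and "slice_curvature (S \<times> T') \<phi> p = slice_curvature (S \<times> T) \<phi> p"
    using assms by (simp_all add: normal_velocity_def drift_def slice_curvature_def r)
qed

text \<open>\<open>plane_curvature\<close> takes unrestricted derivatives of a function known only
  on \<open>S\<close>; since \<open>S\<close> is open, both notions agree, also for the second
  derivative.\<close>

lemma plane_curvature_slice:
  fixes \<phi> :: "real \<times> real \<Rightarrow> minkowski3" and c :: "real \<Rightarrow> real \<times> real"
  assumes C2: "C2_on (S \<times> T) \<phi>" and "open S" "s \<in> S" "t \<in> T"
    and c: "\<And>r. r \<in> S \<Longrightarrow> c r = snd (\<phi> (r, t))"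
  shows "plane_curvature c s = slice_curvature (S \<times> T) \<phi> (s, t)"
proof -
  let ?X = "partial_s (S \<times> T) \<phi>"
  have C1: "C1_on (S \<times> T) \<phi>" "C1_on (S \<times> T) ?X"
    using C2 by (auto simp: C2_on_def)
  have snd_deriv: "vector_derivative f (at r) = snd (partial_s (S \<times> T) g (r, t))"
    if "r \<in> S" "C1_on (S \<times> T) g" "\<And>r. r \<in> S \<Longrightarrow> f r = snd (g (r, t))"
    for f :: "real \<Rightarrow> real \<times> real" and g :: "real \<times> real \<Rightarrow> minkowski3" and r
  proof (rule vector_derivative_at, rule has_vector_derivative_transform_within_open)
    show "((\<lambda>r. snd (g (r, t))) has_vector_derivative snd (partial_s (S \<times> T) g (r, t))) (at r)"
      using C1_on_Times_partials(1)[OF that(2,1) \<open>t \<in> T\<close>] at_within_open[OF that(1) \<open>open S\<close>]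
      by (simp add: bounded_linear.has_vector_derivative[OF bounded_linear_snd])
  qed (use that \<open>open S\<close> in auto)
  have 1: "vector_derivative c (at r) = snd (?X (r, t))" if "r \<in> S" for r
    by (rule snd_deriv[OF that C1(1) c])
  have 2: "vector_derivative (\<lambda>r. vector_derivative c (at r)) (at s) = snd (partial_s (S \<times> T) ?X (s, t))"
    by (rule snd_deriv[OF \<open>s \<in> S\<close> C1(2) 1])
  show ?thesis
    unfolding plane_curvature_def Let_def 2 1[OF \<open>s \<in> S\<close>] slice_curvature_def
    by (simp add: norm_prod_def)
qed

section \<open>From bounded curvature to a bound on \<open>artanh v\<close>\<close>

text \<open>Exponentiating \<open>artanh v = ln ((1 + v) / (1 - v)) / 2\<close> and clearing
  denominators gives inequalities that survive the limit and fail at \<open>v = 1\<close> and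
  \<open>v = - 1\<close>.\<close>

lemma abs_artanh_le:
  fixes v :: real
  assumes "\<bar>v\<bar> < 1" "\<bar>artanh v\<bar> \<le> L"
  shows "1 + v \<le> exp (2 * L) * (1 - v)" "1 - v \<le> exp (2 * L) * (1 + v)"
proof -
  have v: "1 + v > 0" "1 - v > 0" using assms by auto
  have "ln ((1 + v) / (1 - v)) \<le> 2 * L" "- ln ((1 + v) / (1 - v)) \<le> 2 * L"
    using assms(2) by (auto simp: artanh_def)
  then have "ln ((1 + v) / (1 - v)) \<le> 2 * L" "ln ((1 - v) / (1 + v)) \<le> 2 * L"
    using v by (auto simp: ln_div)
  then have "(1 + v) / (1 - v) \<le> exp (2 * L)" "(1 - v) / (1 + v) \<le> exp (2 * L)"
    using v exp_ln[of "(1 + v) / (1 - v)"] exp_ln[of "(1 - v) / (1 + v)"]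
    by (metis divide_pos_pos exp_le_cancel_iff)+
  then show "1 + v \<le> exp (2 * L) * (1 - v)" "1 - v \<le> exp (2 * L) * (1 + v)"
    using v by (auto simp: field_simps)
qed

lemma graph_quantities_continuous:
  fixes \<phi> :: "real \<times> real \<Rightarrow> minkowski3"
  assumes "C1_on D \<phi>" and pos: "\<And>p. p \<in> D \<Longrightarrow>
    (fst (snd (partial_s D \<phi> p)))\<^sup>2 + (snd (snd (partial_s D \<phi> p)))\<^sup>2 > 0"
  shows "continuous_on D (normal_velocity D \<phi>)" "continuous_on D (drift D \<phi>)"
    and "C2_on D \<phi> \<Longrightarrow> continuous_on D (slice_curvature D \<phi>)"
proof -
  have c: "continuous_on D (partial_s D \<phi>)" "continuous_on D (partial_t D \<phi>)"
    using assms(1) by (auto simp: C1_on_def)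
  have ne: "p \<in> D \<Longrightarrow> (fst (snd (partial_s D \<phi> p)))\<^sup>2 + (snd (snd (partial_s D \<phi> p)))\<^sup>2 \<noteq> 0" for p
    using pos[of p] by linarith
  show "continuous_on D (normal_velocity D \<phi>)" "continuous_on D (drift D \<phi>)"
    unfolding normal_velocity_def drift_def Let_def
    by (intro continuous_intros c; use ne in force)+
  show "continuous_on D (slice_curvature D \<phi>)" if "C2_on D \<phi>"
  proof -
    have "continuous_on D (partial_s D (partial_s D \<phi>))"
      using that by (auto simp: C2_on_def C1_on_def)
    then show ?thesis
      unfolding slice_curvature_def Let_def
      by (intro continuous_intros c) (use ne in force)+
  qed
qed

text \<open>A curvature bound near \<open>(s0, t0)\<close> is what the failure of either conclusion
  provides, so this contrapositive form serves both.\<close>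

lemma graph_not_null_if_curvature_bounded:
  fixes \<phi> :: "real \<times> real \<Rightarrow> minkowski3" and \<epsilon> \<delta> s0 t0 C :: real
  defines "S \<equiv> {s0 - \<epsilon><..<s0 + \<epsilon>}" and "T \<equiv> {t0 - \<epsilon><..<t0}" and "T' \<equiv> {t0 - \<epsilon><..t0}"
  assumes imm: "C1_immersion_on (S \<times> T') \<phi>" and C2: "C2_on (S \<times> T) \<phi>"
    and graph: "\<And>p. p \<in> S \<times> T' \<Longrightarrow> fst (\<phi> p) = snd p"
    and timelike: "\<And>p. p \<in> S \<times> T \<Longrightarrow> timelike_at (S \<times> T) \<phi> p"
    and mean: "bounded_mean_curvature_on (S \<times> T) \<phi>"
    and \<delta>: "0 < \<delta>" "\<delta> < \<epsilon>"
    and curv: "\<And>s t. \<bar>s - s0\<bar> \<le> \<delta> \<Longrightarrow> t0 - \<delta> \<le> t \<Longrightarrow> t < t0 \<Longrightarrow>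
      \<bar>slice_curvature (S \<times> T) \<phi> (s, t)\<bar> \<le> C"
  shows "\<not> null_at (S \<times> T') \<phi> (s0, t0)"
proof
  assume null: "null_at (S \<times> T') \<phi> (s0, t0)"
  define v where "v = normal_velocity (S \<times> T) \<phi>"
  have sub: "open T" "T \<subseteq> T'" "open S" "convex T" "convex T'"
    by (auto simp: T_def T'_def S_def)
  have lim: "s islimpt S" "t islimpt T'" if "s \<in> S" "t \<in> T'" for s t
  proof -
    have "infinite S" "infinite T'"
      using \<delta> by (auto simp: S_def T'_def infinite_Ioo infinite_Ioc)
    moreover have "connected S" "connected T'" by (auto simp: S_def T'_def)
    ultimately show "s islimpt S" "t islimpt T'"
      using that by (simp_all add: islimpt_infinite_connected)
  qed
  have C1: "C1_on (S \<times> T') \<phi>" and inj: "\<And>p. p \<in> S \<times> T' \<Longrightarrow> inj (differential (S \<times> T') \<phi> p)"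
    using imm by (auto simp: C1_immersion_on_def)
  have pos: "(fst (snd (partial_s (S \<times> T') \<phi> p)))\<^sup>2 + (snd (snd (partial_s (S \<times> T') \<phi> p)))\<^sup>2 > 0"
    if "p \<in> S \<times> T'" for p
    using graph_timelike_null(3)[OF C1 _ _ lim sub(5) graph, of "fst p" "snd p"] inj[OF that] that
    by (auto simp: mem_Times_iff)
  have p0: "s0 \<in> S" "t0 \<in> T'" using \<delta> by (auto simp: S_def T'_def)
  have v0: "(normal_velocity (S \<times> T') \<phi> (s0, t0))\<^sup>2 = 1"
    by (rule graph_timelike_null(4)[OF C1 p0 lim[OF p0] sub(5) graph]) (use inj p0 null in auto)
  have graphU: "fst (\<phi> p) = snd p" if "p \<in> S \<times> T" for p
    using graph that sub(2) by auto
  have v1: "\<bar>v (s, t)\<bar> < 1" if "s \<in> S" "t \<in> T" for s t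
    using graph_timelike_null(2)[OF _ that _ _ sub(4) graphU] timelike C2 that real_open_islimpt sub(1,3)
    by (auto simp: v_def C2_on_def abs_square_less_1)
  note cont = graph_quantities_continuous[OF C1 pos]
  have v_eq: "v p = normal_velocity (S \<times> T') \<phi> p" and b_eq: "drift (S \<times> T) \<phi> p = drift (S \<times> T') \<phi> p"
    if "p \<in> S \<times> T" for p
    using graph_quantities_restrict[OF sub(1,2) that] by (simp_all add: v_def)
  have contv: "continuous_on (S \<times> T) v"
    using continuous_on_subset[OF cont(1), of "S \<times> T"] sub(2) v_eq
    by (metis Sigma_mono continuous_on_cong subset_refl)

  obtain B where B: "\<And>p \<nu>. p \<in> S \<times> T \<Longrightarrow> unit_normal_at (S \<times> T) \<phi> p \<nu> \<Longrightarrow>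
      \<bar>mean_curvature (S \<times> T) \<phi> p \<nu>\<bar> \<le> B"
    using mean unfolding bounded_mean_curvature_on_def by blast
  have line: "\<exists>d. \<bar>d\<bar> \<le> C + B \<and> ((\<lambda>h. artanh (v (s + h * drift (S \<times> T) \<phi> (s, t), t + h))) has_real_derivative d) (at 0)"
    if st: "\<bar>s - s0\<bar> \<le> \<delta>" "t0 - \<delta> \<le> t" "t < t0" for s t
  proof -
    have p: "s \<in> S" "t \<in> T" using st \<delta> by (auto simp: S_def T_def abs_le_iff)
    obtain \<nu> where \<nu>: "unit_normal_at (S \<times> T) \<phi> (s, t) \<nu>" and
      der: "((\<lambda>h. v (s + h * drift (S \<times> T) \<phi> (s, t), t + h)) has_real_derivative
        (1 - (v (s, t))\<^sup>2) * (slice_curvature (S \<times> T) \<phi> (s, t)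
          - sqrt (1 - (v (s, t))\<^sup>2) * mean_curvature (S \<times> T) \<phi> (s, t) \<nu>)) (at 0)"
      using normal_velocity_line_derivative[OF C2 sub(3,1,4) p graphU timelike] p
      unfolding v_def by blast
    let ?d = "slice_curvature (S \<times> T) \<phi> (s, t) - sqrt (1 - (v (s, t))\<^sup>2) * mean_curvature (S \<times> T) \<phi> (s, t) \<nu>"
    have "(v (s, t))\<^sup>2 < 1" using v1[OF p] by (simp add: abs_square_less_1)
    \<comment> \<open>The derivative \<open>1 / (1 - v\<^sup>2)\<close> of \<open>artanh\<close>
      cancels the degenerate factor.\<close>
    then have "((\<lambda>h. artanh (v (s + h * drift (S \<times> T) \<phi> (s, t), t + h))) has_real_derivative ?d) (at 0)"
      using v1[OF p] by (intro DERIV_cong[OF DERIV_chain2[OF artanh_real_has_field_derivative der]]) auto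
    moreover have "\<bar>?d\<bar> \<le> C + B"
    proof -
      have "sqrt (1 - (v (s, t))\<^sup>2) \<le> 1" "0 \<le> sqrt (1 - (v (s, t))\<^sup>2)"
        using \<open>(v (s, t))\<^sup>2 < 1\<close> by auto
      then have "\<bar>sqrt (1 - (v (s, t))\<^sup>2) * mean_curvature (S \<times> T) \<phi> (s, t) \<nu>\<bar> \<le> 1 * B"
        unfolding abs_mult using B[OF _ \<nu>] p by (intro mult_mono) auto
      then show ?thesis using curv[OF st] by linarith
    qed
    ultimately show ?thesis by blast
  qed

  have box: "cbox (s0 - \<delta>, t0 - \<delta>) (s0 + \<delta>, t0) \<subseteq> S \<times> T'"
    using \<delta> by (auto simp: cbox_Pair_eq S_def T'_def)
  \<comment> \<open>The drift relative to the half-open domain is continuous up to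
    \<open>t0\<close>, so compactness gives one slope \<open>M\<close> for all the cones
    below.\<close>
  have "bounded (drift (S \<times> T') \<phi> ` cbox (s0 - \<delta>, t0 - \<delta>) (s0 + \<delta>, t0))"
    by (intro compact_imp_bounded compact_continuous_image continuous_on_subset[OF cont(2) box] compact_cbox)
  then obtain M where "M > 0" and M: "\<And>s t. \<bar>s - s0\<bar> \<le> \<delta> \<Longrightarrow> t0 - \<delta> \<le> t \<Longrightarrow> t \<le> t0 \<Longrightarrow>
      \<bar>drift (S \<times> T') \<phi> (s, t)\<bar> \<le> M"
    unfolding bounded_pos by (fastforce simp: cbox_Pair_eq abs_le_iff)
  \<comment> \<open>Late enough that every cone of slope \<open>M\<close> with apex
    \<open>(s0, t)\<close>, \<open>t < t0\<close>, and bottom at \<open>t1\<close> stays within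
    distance \<delta> of \<open>s0\<close>, and that \<open>t1\<close> is at least
    \<open>t0 - \<delta>\<close>.\<close>
  define t1 where "t1 = t0 - min \<delta> (\<delta> / M)"
  have t1: "t0 - \<delta> \<le> t1" "t1 < t0" "t1 \<in> T"
    using \<delta> \<open>M > 0\<close> by (auto simp: t1_def T_def)
  have "M * (t0 - t1) \<le> M * (\<delta> / M)"
    using \<open>M > 0\<close> by (intro mult_left_mono) (auto simp: t1_def)
  then have M_t1: "M * (t0 - t1) \<le> \<delta>" using \<open>M > 0\<close> by simp
  have seg: "cbox (s0 - \<delta>) (s0 + \<delta>) \<times> {t1} \<subseteq> S \<times> T"
    using \<delta> t1 by (auto simp: S_def)
  have contw: "continuous_on (S \<times> T) (\<lambda>p. artanh (v p))"
    using v1 by (intro continuous_on_compose2[OF continuous_on_artanh[OF order_refl] contv]) (auto simp: abs_less_iff)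
  then have "bounded ((\<lambda>p. artanh (v p)) ` (cbox (s0 - \<delta>) (s0 + \<delta>) \<times> {t1}))"
    by (intro compact_imp_bounded compact_continuous_image compact_Times compact_cbox
        continuous_on_subset[OF _ seg]) auto
  then obtain A where A: "\<And>s. \<bar>s - s0\<bar> \<le> \<delta> \<Longrightarrow> \<bar>artanh (v (s, t1))\<bar> \<le> A"
    unfolding bounded_iff by (fastforce simp: abs_le_iff)
  \<comment> \<open>Independent of \<open>t\<close>, so the bound persists as \<open>t\<close> tends
    to \<open>t0\<close>.\<close>
  define L where "L = A + \<bar>C + B\<bar> * (t0 - t1)"
  have w_bound: "\<bar>artanh (v (s0, t))\<bar> \<le> L" if "t1 \<le> t" "t < t0" for t
  proof -
    let ?K = "{(s, \<tau>). t1 \<le> \<tau> \<and> \<tau> \<le> t \<and> \<bar>s - s0\<bar> \<le> M * (t - \<tau>)}"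
    have K: "\<bar>s - s0\<bar> \<le> \<delta>" "t0 - \<delta> \<le> \<tau>" "\<tau> < t0" if "(s, \<tau>) \<in> ?K" for s \<tau>
    proof -
      have "M * (t - \<tau>) \<le> M * (t0 - t1)"
        using that \<open>M > 0\<close> \<open>t < t0\<close> by (intro mult_left_mono) auto
      then show "\<bar>s - s0\<bar> \<le> \<delta>" "t0 - \<delta> \<le> \<tau>" "\<tau> < t0"
        using that t1 M_t1 \<open>t < t0\<close> by auto
    qed
    have KU: "?K \<subseteq> S \<times> T"
      using K \<delta> by (fastforce simp: S_def T_def abs_le_iff)
    have bottom: "\<bar>s - s0\<bar> \<le> \<delta>" if "\<bar>s - s0\<bar> \<le> M * (t - t1)" for s
      using K(1)[of s t1] that \<open>t1 \<le> t\<close> by auto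
    \<comment> \<open>The two-sided bound on \<open>d\<close> allows the maximum principle to be
      applied to \<open>artanh v\<close> and to its negative.\<close>
    have char: "\<exists>b d. \<bar>b\<bar> \<le> M \<and> \<bar>d\<bar> \<le> \<bar>C + B\<bar> \<and>
        ((\<lambda>h. artanh (v (s + h * b, \<tau> + h))) has_real_derivative d) (at 0)"
      if "(s, \<tau>) \<in> ?K" for s \<tau>
    proof -
      have "\<bar>drift (S \<times> T) \<phi> (s, \<tau>)\<bar> \<le> M"
        unfolding b_eq[OF subsetD[OF KU that]] using M[of s \<tau>] K[OF that] by simp
      with line[OF K[OF that]] show ?thesis by fastforce
    qed
    have "artanh (v (s0, t)) \<le> A + \<bar>C + B\<bar> * (t - t1)"
    proof (rule transport_maximum_principle[where M = M])
      show "\<exists>b d. \<bar>b\<bar> \<le> M \<and> d \<le> \<bar>C + B\<bar> \<and>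
          ((\<lambda>h. artanh (v (s + h * b, \<tau> + h))) has_real_derivative d) (at 0)"
        if "(s, \<tau>) \<in> ?K" for s \<tau>
        using char[OF that] by (meson abs_le_D1)
      show "artanh (v (s, t1)) \<le> A" if "\<bar>s - s0\<bar> \<le> M * (t - t1)" for s
        using A[OF bottom[OF that]] by linarith
    qed (use continuous_on_subset[OF contw KU] \<open>M > 0\<close> \<open>t1 \<le> t\<close> in auto)
    moreover have "- artanh (v (s0, t)) \<le> A + \<bar>C + B\<bar> * (t - t1)"
    proof (rule transport_maximum_principle[where M = M])
      show "\<exists>b d. \<bar>b\<bar> \<le> M \<and> d \<le> \<bar>C + B\<bar> \<and>
          ((\<lambda>h. - artanh (v (s + h * b, \<tau> + h))) has_real_derivative d) (at 0)"
        if "(s, \<tau>) \<in> ?K" for s \<tau>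
      proof -
        from char[OF that] obtain b d where "\<bar>b\<bar> \<le> M" "\<bar>d\<bar> \<le> \<bar>C + B\<bar>"
          "((\<lambda>h. artanh (v (s + h * b, \<tau> + h))) has_real_derivative d) (at 0)"
          by blast
        then show ?thesis
          by (intro exI[of _ b] exI[of _ "- d"]) (auto intro: DERIV_minus)
      qed
      show "- artanh (v (s, t1)) \<le> A" if "\<bar>s - s0\<bar> \<le> M * (t - t1)" for s
        using A[OF bottom[OF that]] by linarith
    qed (use continuous_on_subset[OF contw KU] \<open>M > 0\<close> \<open>t1 \<le> t\<close> in \<open>auto intro!: continuous_on_minus\<close>)
    moreover have "\<bar>C + B\<bar> * (t - t1) \<le> \<bar>C + B\<bar> * (t0 - t1)"
      using \<open>t < t0\<close> by (intro mult_left_mono) auto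
    ultimately show ?thesis unfolding L_def by linarith
  qed

  \<comment> \<open>The half-open version agrees with \<open>v\<close> for \<open>t < t0\<close> and
    is continuous at \<open>t0\<close>.\<close>
  let ?v' = "\<lambda>t. normal_velocity (S \<times> T') \<phi> (s0, t)" and ?E = "exp (2 * L)"
  have "continuous_on {t1..t0} ?v'"
    using t1 \<delta> p0(1)
    by (intro continuous_on_compose2[OF cont(1)] continuous_intros) (auto simp: T'_def)
  then have "(?v' \<longlongrightarrow> ?v' t0) (at t0 within {t1..t0})"
    using t1 by (auto simp: continuous_on_def)
  then have tends: "(?v' \<longlongrightarrow> ?v' t0) (at_left t0)"
    using at_within_Icc_at_left[OF t1(2)] by simp
  have ev: "\<forall>\<^sub>F t in at_left t0. t1 < t \<and> t < t0"
    using t1(2) eventually_at_left_real by fastforce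
  have bd: "1 + ?v' t \<le> ?E * (1 - ?v' t)" "1 - ?v' t \<le> ?E * (1 + ?v' t)" if "t1 < t" "t < t0" for t
  proof -
    have "t \<in> T" using that t1 by (auto simp: T_def)
    then show "1 + ?v' t \<le> ?E * (1 - ?v' t)" "1 - ?v' t \<le> ?E * (1 + ?v' t)"
      using abs_artanh_le[OF v1 w_bound, of t] p0(1) v_eq that by auto
  qed
  have lims: "((\<lambda>t. 1 + ?v' t) \<longlongrightarrow> 1 + ?v' t0) (at_left t0)"
      "((\<lambda>t. 1 - ?v' t) \<longlongrightarrow> 1 - ?v' t0) (at_left t0)"
    by (intro tendsto_intros tends)+
  have "1 + ?v' t0 \<le> ?E * (1 - ?v' t0)"
    by (rule tendsto_le[OF _ tendsto_mult_left[OF lims(2)] lims(1) eventually_mono[OF ev]]) (use bd in auto)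
  moreover have "1 - ?v' t0 \<le> ?E * (1 + ?v' t0)"
    by (rule tendsto_le[OF _ tendsto_mult_left[OF lims(1)] lims(2) eventually_mono[OF ev]]) (use bd in auto)
  \<comment> \<open>Either value turns one of the two limit inequalities into
    \<open>2 \<le> 0\<close>.\<close>
  moreover have "?v' t0 = 1 \<or> ?v' t0 = - 1"
    using v0 by (simp add: power2_eq_1_iff)
  ultimately show False by auto
qed

section \<open>Blow-up of the curvature and failure of second order regularity\<close>

theorem theorem1p5:
  fixes \<epsilon> s0 t0 :: real
    and \<phi> :: "real \<times> real \<Rightarrow> minkowski3"
    and \<gamma>1 \<gamma>2 :: "real \<times> real \<Rightarrow> real"
  defines "D \<equiv> {s0 - \<epsilon><..<s0 + \<epsilon>} \<times> {t0 - \<epsilon><..t0}"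
    and "U \<equiv> {s0 - \<epsilon><..<s0 + \<epsilon>} \<times> {t0 - \<epsilon><..<t0}"
  assumes "\<epsilon> > 0"
    and "C1_immersion_on D \<phi>"
    and "\<And>s t. (s, t) \<in> D \<Longrightarrow> \<phi> (s, t) = (t, \<gamma>1 (s, t), \<gamma>2 (s, t))"
    and "C2_on U \<phi>"
    and "\<And>p. p \<in> U \<Longrightarrow> timelike_at U \<phi> p"
    and "bounded_mean_curvature_on U \<phi>"
    and "null_at D \<phi> (s0, t0)"
  shows "Limsup (at_left t0) (\<lambda>t. SUP s\<in>{s0 - \<epsilon><..<s0 + \<epsilon>}.
            ereal \<bar>plane_curvature (\<lambda>r. (\<gamma>1 (r, t), \<gamma>2 (r, t))) s\<bar>) = \<infinity>
         \<and> \<not> C2_on D \<phi>"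
proof -
  let ?S = "{s0 - \<epsilon><..<s0 + \<epsilon>}" and ?T = "{t0 - \<epsilon><..<t0}" and ?T' = "{t0 - \<epsilon><..t0}"
  let ?k = "\<lambda>t s. plane_curvature (\<lambda>r. (\<gamma>1 (r, t), \<gamma>2 (r, t))) s"
  have graph: "fst (\<phi> p) = snd p" if "p \<in> D" for p
    using that assms(5) by (cases p) auto
  have unbounded: False
    if "0 < \<delta>" "\<delta> < \<epsilon>" "\<And>s t. \<bar>s - s0\<bar> \<le> \<delta> \<Longrightarrow> t0 - \<delta> \<le> t \<Longrightarrow> t < t0 \<Longrightarrow> \<bar>slice_curvature U \<phi> (s, t)\<bar> \<le> C"
    for \<delta> C
    using graph_not_null_if_curvature_bounded[of s0 \<epsilon> t0 \<phi> \<delta> C, folded D_def U_def] assms graph that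
    by blast
  have k: "?k t s = slice_curvature U \<phi> (s, t)" if "s \<in> ?S" "t \<in> ?T" for s t
    unfolding U_def
    by (rule plane_curvature_slice) (use assms that in \<open>auto simp: U_def D_def\<close>)
  have "Limsup (at_left t0) (\<lambda>t. SUP s\<in>?S. ereal \<bar>?k t s\<bar>) = \<infinity>" (is "?L = _")
  proof (rule ccontr)
    assume "?L \<noteq> \<infinity>"
    then obtain C where "?L < ereal C"
      using ereal_dense2[of ?L \<infinity>] by auto
    then have "\<forall>\<^sub>F t in at_left t0. (SUP s\<in>?S. ereal \<bar>?k t s\<bar>) < ereal C"
      by (rule Limsup_lessD)
    then obtain a where a: "a < t0" "\<And>t. a < t \<Longrightarrow> t < t0 \<Longrightarrow> (SUP s\<in>?S. ereal \<bar>?k t s\<bar>) < ereal C"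
      unfolding eventually_at_left_field by blast
    \<comment> \<open>Halving makes both inequalities strict, so that times from
      \<open>t0 - \<delta>\<close> on lie beyond \<open>a\<close>.\<close>
    define \<delta> where "\<delta> = min \<epsilon> (t0 - a) / 2"
    have \<delta>: "0 < \<delta>" "\<delta> < \<epsilon>" "\<delta> < t0 - a"
      using a(1) \<open>\<epsilon> > 0\<close> by (auto simp: \<delta>_def min_def)
    show False
    proof (rule unbounded[OF \<delta>(1,2), of C])
      fix s t assume st: "\<bar>s - s0\<bar> \<le> \<delta>" "t0 - \<delta> \<le> t" "t < t0"
      then have mem: "s \<in> ?S" "t \<in> ?T" using \<delta> by (auto simp: abs_le_iff)
      have "ereal \<bar>?k t s\<bar> \<le> (SUP s\<in>?S. ereal \<bar>?k t s\<bar>)"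
        by (rule SUP_upper[OF mem(1)])
      also have "\<dots> < ereal C"
        using a(2) st \<delta> by auto
      finally show "\<bar>slice_curvature U \<phi> (s, t)\<bar> \<le> C"
        using k[OF mem] by simp
    qed
  qed
  moreover have "\<not> C2_on D \<phi>"
  proof
    assume C2: "C2_on D \<phi>"
    have C1: "C1_on D \<phi>" and inj: "\<And>p. p \<in> D \<Longrightarrow> inj (differential D \<phi> p)"
      using assms(4) by (auto simp: C1_immersion_on_def)
    have inf: "infinite ?S" "infinite ?T'" "connected ?S" "connected ?T'"
      using \<open>\<epsilon> > 0\<close> by (auto simp: infinite_Ioo infinite_Ioc)
    have pos: "(fst (snd (partial_s D \<phi> p)))\<^sup>2 + (snd (snd (partial_s D \<phi> p)))\<^sup>2 > 0" if "p \<in> D" for p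
    proof -
      have mem: "fst p \<in> ?S" "snd p \<in> ?T'" using that by (auto simp: D_def)
      have "fst p islimpt ?S" "snd p islimpt ?T'"
        using mem inf islimpt_infinite_connected[of ?S] islimpt_infinite_connected[of ?T'] by blast+
      from graph_timelike_null(3)[OF C1[unfolded D_def] mem this _ graph[unfolded D_def]] inj[OF that]
      show ?thesis by (simp add: D_def)
    qed
    define \<delta> where "\<delta> = \<epsilon> / 2"
    have \<delta>: "0 < \<delta>" "\<delta> < \<epsilon>" using \<open>\<epsilon> > 0\<close> by (auto simp: \<delta>_def)
    have box: "cbox (s0 - \<delta>, t0 - \<delta>) (s0 + \<delta>, t0) \<subseteq> D"
      using \<delta> by (auto simp: cbox_Pair_eq D_def)
    \<comment> \<open>The box reaches up to \<open>t = t0\<close>; continuity of the curvature there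
      comes from \<open>C2\<close> and from \<open>\<gamma>\<^sub>s\<close> being nonzero for an
      immersion.\<close>
    have "bounded (slice_curvature D \<phi> ` cbox (s0 - \<delta>, t0 - \<delta>) (s0 + \<delta>, t0))"
      by (intro compact_imp_bounded compact_continuous_image compact_cbox
          continuous_on_subset[OF graph_quantities_continuous(3)[OF C1 pos C2] box])
    then obtain C where C: "\<And>s t. \<bar>s - s0\<bar> \<le> \<delta> \<Longrightarrow> t0 - \<delta> \<le> t \<Longrightarrow> t \<le> t0 \<Longrightarrow>
        \<bar>slice_curvature D \<phi> (s, t)\<bar> \<le> C"
      unfolding bounded_iff by (fastforce simp: cbox_Pair_eq abs_le_iff)
    show False
    proof (rule unbounded[OF \<delta>, of C])
      fix s t assume st: "\<bar>s - s0\<bar> \<le> \<delta>" "t0 - \<delta> \<le> t" "t < t0"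
      then have "(s, t) \<in> U" using \<delta> by (auto simp: U_def abs_le_iff)
      then have "slice_curvature D \<phi> (s, t) = slice_curvature U \<phi> (s, t)"
        unfolding D_def U_def by (intro graph_quantities_restrict(3)) auto
      then show "\<bar>slice_curvature U \<phi> (s, t)\<bar> \<le> C"
        using C[of s t] st by simp
    qed
  qed
  ultimately show ?thesis by blast
qed

end
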